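(* Let $p$ be a prime with $p\equiv 9$ or $13 \bmod 16$ such that $r=\frac{p-3}{2}$ is an odd prime and $2$ is a primitive root modulo $r$. Let $(t_n)_{n\ge 0}$ be the $(p-3)/2$-periodic binary sequence defined in the context. Then the linear complexity $L(t_n)$ of $(t_n)$ over $\mathbb{F}_2$ is $$L(t_n)=\begin{cases} \frac{p-3}{2}, & p\equiv 9 \bmod 16,\\ \frac{p-5}{2}, & p\equiv 13 \bmod 16.\end{cases}$$
   Context: For a prime $p\ge 5$, let $q_0,q_1,\ldots,q_{(p-3)/2}$ be the (nonzero) quadratic residues modulo $p$, represented as integers in increasing order, $1=q_0<q_1<\cdots<q_{(p-3)/2}\le p-1$. The sequence $(t_n)_{n\ge 0}$ with values in $\{0,1\}=\mathbb{F}_2$ is defined by $t_n=1$ if $q_{n+1}=q_n+1$ and $t_n=0$ if $q_{n+1}\ne q_n+1$, for $n=0,1,\ldots,(p-5)/2$, and is continued periodically by $t_{n+(p-3)/2}=t_n$ for all $n\ge 0$. The linear complexity $L(s_n)$ of a sequence $(s_n)_{n\ge0}$ over $\mathbb{F}_2$ is the length $L$ of the shortest linear recurrence $s_{n+L}=c_{L-1}s_{n+L-1}+\cdots+c_0s_n$, $n=0,1,\ldots$, with coefficients $c_0,\ldots,c_{L-1}\in\mathbb{F}_2$, satisfied by the sequence. *)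

theory Defs
  imports "HOL-Number_Theory.Number_Theory" "HOL-Library.Z2"
begin

definition quad_residue :: "nat \<Rightarrow> nat \<Rightarrow> nat" where
  "quad_residue p n = sorted_list_of_set {a \<in> {1..<p}. QuadRes (int p) (int a)} ! n"

(* For a prime p >= 5 there are (p-1)/2 residues, so the list index m + 1 below never
   exceeds the last valid index (p-3)/2; reducing n modulo (p-3)/2 is the periodic continuation. *)
definition t_seq :: "nat \<Rightarrow> nat \<Rightarrow> bit" where
  "t_seq p n = (let m = n mod ((p - 3) div 2) in
     if quad_residue p (m + 1) = quad_residue p m + 1 then 1 else 0)"

(* L = 0 is allowed (empty sum) and is attained exactly by the zero sequence. For a sequence
   with no linear recurrence LEAST is unspecified; periodic sequences always have one. *)
definition linear_complexity :: "(nat \<Rightarrow> bit) \<Rightarrow> nat" where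
  "linear_complexity s =
     (LEAST L. \<exists>c :: nat \<Rightarrow> bit. \<forall>n. s (n + L) = (\<Sum>i<L. c i * s (n + i)))"

end

theory Submission
  imports Defs
begin

text \<open>
  Let \<open>s\<close> be a binary sequence of odd prime period \<open>r\<close>, where \<open>2\<close> is a primitive root modulo \<open>r\<close>.
  The usual argument is that \<open>X^r - 1 = (X - 1) * (1 + X + \<dots> + X^(r-1))\<close> with an irreducible second
  factor over the field with two elements, so that a nonconstant \<open>s\<close> has a minimal polynomial of
  degree \<open>r - 1\<close> or \<open>r\<close>, depending on whether its sum over a period vanishes. The proof below replaces
  factorization by a direct averaging argument. If a polynomial \<open>f\<close> annihilates \<open>s\<close>, then so does
  \<open>f^2 = f(X^2)\<close>, hence every \<open>f(X^(2^k))\<close>, and as the powers of \<open>2\<close> exhaust the nonzero residues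
  modulo \<open>r\<close>, every \<open>f(X^m)\<close> with \<open>m\<close> prime to \<open>r\<close> (\<open>annihilator_coprime_step\<close>). Summing these relations
  over \<open>m\<close> forces all coefficients of an annihilator of degree less than \<open>r\<close> to agree
  (\<open>annihilator_coefficients_constant\<close>), so the only nonzero candidate is \<open>1 + X + \<dots> + X^(r-1)\<close>,
  which annihilates \<open>s\<close> exactly if the sum of \<open>s\<close> over a period is \<open>0\<close>
  (\<open>linear_complexity_prime_period\<close>).

  For the sequence \<open>t\<close> this sum is the parity of the number of \<open>a\<close> such that \<open>a\<close> and \<open>a + 1\<close> are both
  quadratic residues. Since \<open>-1\<close> is a residue, the reflection \<open>a \<mapsto> p - 1 - a\<close> acts on these \<open>a\<close>;
  its one possible fixed point is \<open>(p - 1) / 2 = - 1 / 2\<close>, which qualifies exactly if \<open>2\<close> is a residue.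
  The supplementary law for \<open>2\<close> thus decides between the two cases
  (\<open>odd_card_consecutive_residues_iff\<close>). It remains to see that \<open>t\<close> is not constant: one of the
  pairs \<open>(1, 2)\<close>, \<open>(4, 5)\<close>, \<open>(9, 10)\<close> consists of residues, and the residues do not form an interval.
\<close>

section \<open>Annihilating polynomials of a periodic binary sequence\<close>

text \<open>
  The default simplification of bit arithmetic to Boolean operations is switched off because the
  arguments below use the field structure.
\<close>

declare add_bit_eq_xor [simp del] mult_bit_eq_and [simp del]

lemma bit_add_self [simp]: "x + x = (0::bit)"
  by (cases x) simp_all

lemma bit_mult_self [simp]: "x * x = (x::bit)"
  by (cases x) simp_all

lemma bit_add_eq_0_iff: "x + y = 0 \<longleftrightarrow> x = (y::bit)"
  by (cases x; cases y) simp_all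

lemma of_nat_bit_eq_0_iff: "of_nat n = (0::bit) \<longleftrightarrow> even n"
proof (induction n)
  case (Suc n)
  then show ?case
    by (cases "of_nat n :: bit") simp_all
qed simp

text \<open>In characteristic \<open>2\<close> the two equal off-diagonal halves of the sum cancel.\<close>

lemma symmetric_double_sum_bit:
  fixes g :: "nat \<Rightarrow> nat \<Rightarrow> bit"
  assumes "\<And>i j. g i j = g j i"
  shows "(\<Sum>j<N. \<Sum>i<N. g i j) = (\<Sum>i<N. g i i)"
proof (induction N)
  case (Suc N)
  have "(\<Sum>j<Suc N. \<Sum>i<Suc N. g i j) =
      (\<Sum>j<N. \<Sum>i<N. g i j) + ((\<Sum>j<N. g N j) + (\<Sum>i<N. g i N)) + g N N"
    by (simp add: sum.distrib add_ac)
  also have "(\<Sum>i<N. g i N) = (\<Sum>j<N. g N j)"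
    by (intro sum.cong) (auto intro: assms)
  finally show ?case
    using Suc by simp
qed simp

text \<open>
  The coefficients \<open>c\<close> stand for the polynomial \<open>f = (\<Sum>i<N. c i * X^i)\<close> acting by the shift, and
  the hypothesis says that \<open>f(X^m)\<close> annihilates \<open>s\<close>. Its square annihilates \<open>s\<close> as well and equals
  \<open>f(X^(2*m))\<close>, as the mixed terms of the square cancel.
\<close>

lemma annihilator_doubled_step:
  fixes c s :: "nat \<Rightarrow> bit"
  assumes "\<And>n. (\<Sum>i<N. c i * s (n + m * i)) = 0"
  shows "(\<Sum>i<N. c i * s (n + 2 * m * i)) = 0"
proof -
  have "0 = (\<Sum>j<N. c j * (\<Sum>i<N. c i * s ((n + m * j) + m * i)))"
    using assms by simp
  also have "\<dots> = (\<Sum>j<N. \<Sum>i<N. c i * c j * s (n + m * (i + j)))"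
    by (simp add: sum_distrib_left algebra_simps)
  also have "\<dots> = (\<Sum>i<N. c i * c i * s (n + m * (i + i)))"
    by (rule symmetric_double_sum_bit) (simp add: mult_ac add_ac)
  also have "\<dots> = (\<Sum>i<N. c i * s (n + 2 * m * i))"
    by (intro sum.cong) (simp_all add: mult_2 ring_distribs)
  finally show ?thesis ..
qed

lemma annihilator_power_of_2_step:
  fixes c s :: "nat \<Rightarrow> bit"
  assumes "\<And>n. (\<Sum>i<N. c i * s (n + i)) = 0"
  shows "(\<Sum>i<N. c i * s (n + 2 ^ k * i)) = 0"
proof (induction k arbitrary: n)
  case 0
  show ?case using assms by simp
next
  case (Suc k)
  show ?case
    using annihilator_doubled_step[where m = "2 ^ k"] Suc by simp
qed

lemma periodic_cong:
  fixes s :: "nat \<Rightarrow> 'a"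
  assumes "\<And>n. s (n + r) = s n" "[x = y] (mod r)"
  shows "s x = s y"
proof -
  have "s (x + r * k) = s x" for x k
    by (induction k) (simp_all add: assms(1) add.assoc[symmetric] add.commute[of r])
  then have "s (x mod r + r * (x div r)) = s (x mod r)" for x
    by blast
  then have "s x = s (x mod r)" for x
    by simp
  then show ?thesis
    using assms(2) unfolding cong_def by metis
qed

text \<open>
  By periodicity only \<open>m\<close> modulo \<open>r\<close> matters, and modulo \<open>r\<close> it is a power of the primitive root \<open>2\<close>.
\<close>

lemma annihilator_coprime_step:
  fixes c s :: "nat \<Rightarrow> bit"
  assumes per: "\<And>n. s (n + r) = s n"
    and "residue_primroot r 2" "r > 1" "coprime m r"
    and ann: "\<And>n. (\<Sum>i<N. c i * s (n + i)) = 0"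
  shows "(\<Sum>i<N. c i * s (n + m * i)) = 0"
proof -
  have "m mod r \<in> totatives r"
    using assms by (auto simp: in_totatives_iff coprime_commute intro!: Nat.gr0I)
  also have "totatives r = (\<lambda>k. 2 ^ k mod r) ` {..<totient r}"
    using residue_primroot_is_generator[of r 2] assms by (simp add: bij_betw_def)
  finally obtain k where "2 ^ k mod r = m mod r"
    by auto
  then have "[n + m * i = n + 2 ^ k * i] (mod r)" for i
    by (intro cong_add cong_mult) (auto simp: cong_def)
  then have "s (n + m * i) = s (n + 2 ^ k * i)" for i
    using periodic_cong[of s r, OF per] by blast
  then show ?thesis
    using annihilator_power_of_2_step[OF ann] by simp
qed

lemma sum_over_progression:
  fixes s :: "nat \<Rightarrow> 'a :: comm_monoid_add"
  assumes per: "\<And>n. s (n + r) = s n" and "r > 0" "coprime d r"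
  shows "(\<Sum>m<r. s (n + m * d)) = (\<Sum>m<r. s m)"
proof -
  let ?h = "\<lambda>m. (n + m * d) mod r"
  have "inj_on ?h {..<r}"
  proof (rule inj_onI)
    fix x y assume xy: "x \<in> {..<r}" "y \<in> {..<r}" "?h x = ?h y"
    then have "[n + x * d = n + y * d] (mod r)"
      by (simp add: cong_def)
    then have "[x = y] (mod r)"
      using assms(3) by (simp add: cong_add_lcancel_nat cong_mult_rcancel_nat)
    then show "x = y"
      using xy by (simp add: cong_def)
  qed
  moreover have "?h ` {..<r} \<subseteq> {..<r}"
    using assms(2) by auto
  ultimately have "bij_betw ?h {..<r} {..<r}"
    by (simp add: bij_betw_def endo_inj_surj)
  then have "(\<Sum>m<r. s (?h m)) = (\<Sum>m<r. s m)"
    by (rule sum.reindex_bij_betw)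
  moreover have "s (?h m) = s (n + m * d)" for m
    by (rule periodic_cong[of s r, OF per]) (simp add: cong_def)
  ultimately show ?thesis
    by simp
qed

text \<open>
  Multiplying \<open>f\<close> by \<open>X^(r-k)\<close> moves the coefficient \<open>f k\<close> to an exponent divisible by \<open>r\<close>. Now
  substitute \<open>X^m\<close> for \<open>X\<close> and sum the resulting relations over \<open>0 < m < r\<close>. The coefficient \<open>f k\<close>
  meets \<open>r - 1\<close> copies of \<open>s n\<close>, which cancel because \<open>r - 1\<close> is even; every other coefficient meets
  each term of a period except \<open>s n\<close>, that is \<open>T + s n\<close>, where \<open>T\<close> is the sum over a period.
  Choosing \<open>n\<close> with \<open>T + s n = 1\<close> shows that the coefficients other than \<open>f k\<close> add up to \<open>0\<close>.
\<close>

lemma annihilator_coefficients_constant: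
  fixes f s :: "nat \<Rightarrow> bit"
  assumes per: "\<And>n. s (n + r) = s n"
    and r: "prime r" "odd r" "residue_primroot r 2"
    and nonconst: "\<And>b. \<exists>n. s n \<noteq> b"
    and ann: "\<And>n. (\<Sum>i<r. f i * s (n + i)) = 0"
    and k: "k < r"
  shows "f k = (\<Sum>i<r. f i)"
proof -
  have r1: "r > 1"
    using r(1) by (rule prime_gt_1_nat)
  define T where "T = (\<Sum>m<r. s m)"
  obtain n where n: "s n \<noteq> T"
    using nonconst by blast
  have inner: "(\<Sum>m\<in>{1..<r}. s (n + m * (i + (r - k)))) = (if i = k then 0 else 1)"
    if "i < r" for i
  proof (cases "i = k")
    case True
    have "s (n + m * (i + (r - k))) = s n" for m
      using True k by (intro periodic_cong[of s r, OF per]) (simp add: cong_def)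
    moreover have "even (r - 1)"
      using r(2) by simp
    then obtain q where "r - 1 = 2 * q" ..
    then have "of_nat (r - 1) = (0::bit)"
      by simp
    ultimately show ?thesis
      using True by (simp del: of_nat_diff)
  next
    case False
    have "\<not> r dvd i + (r - k)"
    proof
      assume "r dvd i + (r - k)"
      then obtain q where q: "i + (r - k) = r * q" ..
      have "0 < r * q" "r * q < r * 2"
        using q k that by linarith+
      then have "q = 1"
        by simp
      then show False
        using q k False by simp
    qed
    then have "coprime (i + (r - k)) r"
      using r(1) by (simp add: prime_imp_coprime coprime_commute)
    then have "T = (\<Sum>m<r. s (n + m * (i + (r - k))))"
      using sum_over_progression[of s r, OF per] r1 T_def by simp
    also have "{..<r} = insert 0 {1..<r}"
      using r1 by auto
    also have "(\<Sum>m\<in>insert 0 {1..<r}. s (n + m * (i + (r - k)))) =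
        s n + (\<Sum>m\<in>{1..<r}. s (n + m * (i + (r - k))))"
      by (subst sum.insert) auto
    finally show ?thesis
      using n False by (cases "s n"; cases T) (auto simp: bit_add_eq_0_iff)
  qed
  \<comment> \<open>The shift by \<open>X^(r-k)\<close> becomes a change of the starting point \<open>n\<close>.\<close>
  have "(\<Sum>i<r. f i * s ((n + m * (r - k)) + m * i)) = 0" if "m \<in> {1..<r}" for m
  proof (rule annihilator_coprime_step[OF per r(3) r1 _ ann])
    have "\<not> r dvd m"
      using that by (auto dest: dvd_imp_le)
    then show "coprime m r"
      using r(1) prime_imp_coprime coprime_commute by blast
  qed
  then have "0 = (\<Sum>m\<in>{1..<r}. \<Sum>i<r. f i * s ((n + m * (r - k)) + m * i))"
    by simp
  also have "\<dots> = (\<Sum>i<r. f i * (\<Sum>m\<in>{1..<r}. s (n + m * (i + (r - k)))))"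
    by (subst sum.swap) (simp add: sum_distrib_left algebra_simps)
  also have "\<dots> = (\<Sum>i<r. f i * (if i = k then 0 else 1))"
    using inner by (intro sum.cong) auto
  also have "\<dots> = (\<Sum>i\<in>{..<r} - {k}. f i)"
    using k by (subst sum.remove[of _ k]) auto
  finally show ?thesis
    using k by (subst sum.remove[of _ k]) auto
qed

text \<open>
  A recurrence of length \<open>L < r\<close> is an annihilator with leading coefficient \<open>1\<close> and degree \<open>L\<close>. All its
  coefficients up to index \<open>r - 1\<close> equal that \<open>1\<close>, so \<open>L = r - 1\<close> and the sum of \<open>s\<close> over a period
  vanishes. Conversely that sum being \<open>0\<close> is itself a recurrence of length \<open>r - 1\<close>, and the period
  always gives one of length \<open>r\<close>.
\<close>

theorem linear_complexity_prime_period: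
  fixes s :: "nat \<Rightarrow> bit"
  assumes per: "\<And>n. s (n + r) = s n"
    and r: "prime r" "odd r" "residue_primroot r 2"
    and nonconst: "\<And>b. \<exists>n. s n \<noteq> b"
  shows "linear_complexity s = (if (\<Sum>m<r. s m) = 0 then r - 1 else r)"
  unfolding linear_complexity_def
proof (rule Least_equality, goal_cases)
  case 1
  have r1: "r > 1"
    using r(1) by (rule prime_gt_1_nat)
  show ?case
  proof (cases "(\<Sum>m<r. s m) = 0")
    case True
    have "s (n + (r - 1)) = (\<Sum>i<r - 1. 1 * s (n + i))" for n
    proof -
      have "0 = (\<Sum>i<Suc (r - 1). s (n + i))"
        using True sum_over_progression[of s r 1 n] per r1 by simp
      then show ?thesis
        by (metis (no_types, lifting) sum.lessThan_Suc bit_add_eq_0_iff mult_1 sum.cong)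
    qed
    then show ?thesis
      using True by (intro exI[of _ "\<lambda>_. 1"]) simp
  next
    case False
    have "s (n + r) = (\<Sum>i<r. (if i = 0 then 1 else 0) * s (n + i))" for n
    proof -
      have "(\<Sum>i<r. (if i = 0 then 1 else 0) * s (n + i)) = (\<Sum>i<r. if i = 0 then s n else 0)"
        by (intro sum.cong) auto
      then show ?thesis
        using r1 per by simp
    qed
    then show ?thesis
      using False by (intro exI[of _ "\<lambda>i. if i = 0 then 1 else 0"]) simp
  qed
next
  case (2 L)
  then obtain c where c: "\<And>n. s (n + L) = (\<Sum>i<L. c i * s (n + i))"
    by blast
  show ?case
  proof (cases "L < r")
    case True
    define f where "f i = (if i < L then c i else if i = L then 1 else 0)" for i
    have "(\<Sum>i<r. f i * s (n + i)) = 0" for n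
    proof -
      have "(\<Sum>i<r. f i * s (n + i)) = (\<Sum>i<Suc L. f i * s (n + i))"
        using True by (intro sum.mono_neutral_right) (auto simp: f_def)
      also have "\<dots> = (\<Sum>i<L. c i * s (n + i)) + s (n + L)"
        by (simp add: f_def)
      finally show ?thesis
        by (simp add: c)
    qed
    note ann = this
    have const: "f k = (\<Sum>i<r. f i)" if "k < r" for k
      using annihilator_coefficients_constant[OF per r nonconst ann that] .
    have one: "f k = 1" if "k < r" for k
      using const[OF True] const[OF that] by (simp add: f_def)
    have "f (r - 1) = 1"
      using one True by simp
    then have "r - 1 \<le> L"
      by (auto simp: f_def split: if_splits)
    moreover have "(\<Sum>m<r. s m) = 0"
      using ann[of 0] one by simp
    ultimately show ?thesis
      by simp
  qed auto
qed


section \<open>Quadratic residues\<close>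

lemma eq_if_cong_near:
  assumes "[x = y] (mod m)" "\<bar>x - y\<bar> < (m::int)"
  shows "x = y"
proof (rule ccontr)
  assume "x \<noteq> y"
  then have "\<bar>m\<bar> \<le> \<bar>x - y\<bar>"
    using assms(1) by (intro dvd_imp_le_int) (simp_all add: cong_iff_dvd_diff)
  then show False
    using assms(2) by linarith
qed

lemma Legendre_cong:
  "[a = b] (mod p) \<Longrightarrow> Legendre a p = Legendre b p"
  by (simp add: Legendre_def QuadRes_def cong_def)

text \<open>
  Euler's criterion yields the identity modulo \<open>p\<close>; it is an equality because both sides lie
  between \<open>-1\<close> and \<open>1\<close> and \<open>p > 2\<close>.
\<close>

lemma Legendre_mult:
  assumes "prime p" "p > 2"
  shows "Legendre (a * b) (int p) = Legendre a (int p) * Legendre b (int p)"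
proof -
  let ?h = "(p - 1) div 2"
  have "[Legendre a p * Legendre b p = a ^ ?h * b ^ ?h] (mod p)"
    using assms by (intro cong_mult euler_criterion) auto
  moreover have "[Legendre (a * b) p = a ^ ?h * b ^ ?h] (mod p)"
    using euler_criterion[OF assms, of "a * b"] by (simp add: power_mult_distrib)
  ultimately have "[Legendre (a * b) p = Legendre a p * Legendre b p] (mod p)"
    by (metis cong_sym cong_trans)
  moreover have "\<bar>Legendre (a * b) p - Legendre a p * Legendre b p\<bar> < int p"
    using assms by (simp add: Legendre_def)
  ultimately show ?thesis
    by (rule eq_if_cong_near)
qed

text \<open>
  This follows from the Gauss lemma: among \<open>2, 4, \<dots>, 4 * k\<close>, which are already reduced modulo \<open>p\<close>,
  exactly the \<open>k\<close> numbers above \<open>2 * k\<close> exceed \<open>(p - 1) / 2\<close>.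
\<close>

lemma Legendre_two:
  assumes "prime p" "p = 4 * k + 1"
  shows "Legendre 2 (int p) = (-1) ^ k"
proof -
  have k: "k > 0"
    using assms by (intro Nat.gr0I) auto
  have "\<not> int p dvd 2"
    using k assms(2) by (auto dest: zdvd_imp_le)
  then interpret GAUSS p 2
    using assms k by unfold_locales (auto simp: cong_0_iff)
  have "E = (\<lambda>x. x * 2) ` {int k <.. 2 * int k}"
  proof -
    have "C = B"
      unfolding C_def B_def A_def image_image
      by (rule image_cong) (use assms(2) in auto)
    then show ?thesis
      unfolding E_def B_def A_def using assms(2) by auto
  qed
  then have "card E = k"
    by (simp add: card_image inj_on_def)
  then show ?thesis
    using gauss_lemma by simp
qed

definition quad_residues :: "nat \<Rightarrow> nat set" where
  "quad_residues p = {a \<in> {1..<p}. QuadRes (int p) (int a)}"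

lemma finite_quad_residues [simp]: "finite (quad_residues p)"
  by (simp add: quad_residues_def)

lemma quad_residues_iff_Legendre:
  assumes "0 < a" "a < p"
  shows "a \<in> quad_residues p \<longleftrightarrow> Legendre (int a) (int p) = 1"
proof -
  have "\<not> [int a = 0] (mod int p)"
    using assms by (simp add: cong_0_iff nat_dvd_not_less)
  then show ?thesis
    using assms by (simp add: quad_residues_def Legendre_def)
qed

lemma Legendre_cases_nat:
  assumes "0 < a" "a < p"
  shows "Legendre (int a) (int p) = 1 \<or> Legendre (int a) (int p) = -1"
proof -
  have "\<not> [int a = 0] (mod int p)"
    using assms by (simp add: cong_0_iff nat_dvd_not_less)
  then show ?thesis
    by (simp add: Legendre_def)
qed

lemma power2_mem_quad_residues:
  assumes "0 < x" "x ^ 2 < p"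
  shows "x ^ 2 \<in> quad_residues p"
  using assms by (auto simp: quad_residues_def QuadRes_def Suc_le_eq intro!: exI[of _ "int x"])

text \<open>
  Each residue is the square of exactly one element of \<open>{1..(p - 1) div 2}\<close>, as its square roots
  come in pairs \<open>z\<close>, \<open>p - z\<close>.
\<close>

lemma card_quad_residues:
  assumes "prime p" "p > 2"
  shows "card (quad_residues p) = (p - 1) div 2"
proof -
  let ?h = "(p - 1) div 2"
  let ?sq = "\<lambda>x. x ^ 2 mod p"
  have "odd p"
    using assms prime_odd_nat by blast
  then have p: "p = 2 * ?h + 1"
    by simp
  have "inj_on ?sq {1..?h}"
  proof (rule linorder_inj_onI')
    fix x y assume xy: "x \<in> {1..?h}" "y \<in> {1..?h}" "x < y"
    show "?sq x \<noteq> ?sq y"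
    proof
      assume "?sq x = ?sq y"
      then have "[y ^ 2 = x ^ 2] (mod p)"
        by (simp add: cong_def)
      then have "p dvd y ^ 2 - x ^ 2"
        using xy by (simp add: cong_altdef_nat)
      also have "y ^ 2 - x ^ 2 = (y - x) * (y + x)"
        using xy by (simp add: power2_eq_square algebra_simps)
      finally have "p dvd y - x \<or> p dvd y + x"
        using assms(1) by (simp add: prime_dvd_mult_iff)
      then have "p \<le> y - x \<or> p \<le> y + x"
        using xy by (auto dest: dvd_imp_le)
      then show False
        using xy p by auto
    qed
  qed
  moreover have "?sq ` {1..?h} = quad_residues p"
  proof (intro equalityI subsetI)
    fix a assume "a \<in> ?sq ` {1..?h}"
    then obtain x where x: "x \<in> {1..?h}" "a = ?sq x"
      by auto
    have "\<not> p dvd x"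
      using x p by (auto dest: dvd_imp_le)
    then have "a \<noteq> 0"
      using assms(1) x by (auto simp: mod_eq_0_iff_dvd prime_dvd_power_iff)
    moreover have "[int x ^ 2 = int a] (mod int p)"
      by (simp add: x cong_def zmod_int)
    ultimately show "a \<in> quad_residues p"
      using x assms by (auto simp: quad_residues_def QuadRes_def)
  next
    fix a assume a: "a \<in> quad_residues p"
    then obtain y where y: "[y ^ 2 = int a] (mod int p)" and a': "0 < a" "a < p"
      by (auto simp: quad_residues_def QuadRes_def)
    define z where "z = nat (y mod int p)"
    have zp: "z < p"
      using assms by (simp add: z_def nat_less_iff)
    have "int (z ^ 2 mod p) = y ^ 2 mod int p"
      using assms by (simp add: z_def zmod_int power_mod)
    also have "\<dots> = int a"
      using y a' by (simp add: cong_def)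
    finally have z: "z ^ 2 mod p = a"
      by simp
    have "z \<noteq> 0"
      using z a' by (intro notI) simp
    show "a \<in> ?sq ` {1..?h}"
    proof (cases "z \<le> ?h")
      case True
      then show ?thesis
        using z \<open>z \<noteq> 0\<close> by (intro image_eqI[of _ _ z]) auto
    next
      case False
      have "int ((p - z) ^ 2 mod p) = (int p - int z) ^ 2 mod int p"
        using zp by (simp add: zmod_int of_nat_diff)
      also have "\<dots> = (int z) ^ 2 mod int p"
      proof -
        have "[(int p - int z) ^ 2 = (- int z) ^ 2] (mod int p)"
          by (intro cong_pow) (simp add: cong_iff_dvd_diff)
        then show ?thesis
          by (simp add: cong_def)
      qed
      also have "\<dots> = int (z ^ 2 mod p)"
        by (simp add: zmod_int)
      finally have "(p - z) ^ 2 mod p = a"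
        using z by simp
      then show ?thesis
        using False zp p by (intro image_eqI[of _ _ "p - z"]) auto
    qed
  qed
  ultimately show ?thesis
    using card_image by fastforce
qed

text \<open>For \<open>p \<equiv> 1\<close> modulo \<open>4\<close> the number \<open>-1\<close> is a quadratic residue, by Euler's criterion.\<close>

lemma minus_mem_quad_residues_iff:
  assumes "prime p" "p mod 4 = 1" "0 < a" "a < p"
  shows "p - a \<in> quad_residues p \<longleftrightarrow> a \<in> quad_residues p"
proof -
  have "even ((p - 1) div 2)"
    using assms(2) by presburger
  moreover have p2: "p > 2"
    using assms prime_ge_2_nat[of p] by (cases "p = 2") auto
  ultimately have "[Legendre (-1) p = 1] (mod p)"
    using euler_criterion[of p "-1"] assms(1) by simp
  moreover have "\<bar>Legendre (-1) (int p) - 1\<bar> < int p"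
    using p2 by (simp add: Legendre_def)
  ultimately have "Legendre (-1) p = 1"
    by (rule eq_if_cong_near)
  moreover have "Legendre (int (p - a)) p = Legendre (- 1 * int a) p"
    using assms by (intro Legendre_cong) (simp add: cong_iff_dvd_diff of_nat_diff)
  ultimately have "Legendre (int (p - a)) p = Legendre (int a) p"
    using Legendre_mult[OF assms(1) p2, of "-1" "int a"] by simp
  then show ?thesis
    using assms by (simp add: quad_residues_iff_Legendre)
qed


section \<open>Neighbouring quadratic residues\<close>

definition consecutive_residues :: "nat \<Rightarrow> nat set" where
  "consecutive_residues p = {a \<in> quad_residues p. Suc a \<in> quad_residues p}"

lemma finite_consecutive_residues [simp]: "finite (consecutive_residues p)"
  by (simp add: consecutive_residues_def)

text \<open>
  The reflection \<open>a \<mapsto> p - 1 - a = 4 * k - a\<close> pairs the elements below \<open>2 * k\<close> with those above, so the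
  parity depends on the midpoint \<open>2 * k\<close> alone. As \<open>2 * (2 * k) = p - 1\<close> is a residue, \<open>2 * k\<close> is one
  exactly if \<open>2\<close> is.
\<close>

lemma odd_card_consecutive_residues_iff:
  assumes "prime p" "p = 4 * k + 1"
  shows "odd (card (consecutive_residues p)) \<longleftrightarrow> even k"
proof -
  let ?A = "consecutive_residues p"
  let ?lo = "{a \<in> ?A. a < 2 * k}" and ?hi = "{a \<in> ?A. 2 * k < a}"
  have p4: "p mod 4 = 1"
    using assms(2) by simp
  have k: "k > 0"
    using assms by (intro Nat.gr0I) auto
  have reflect: "2 * (2 * k) - a \<in> ?A" if "a \<in> ?A" for a
  proof -
    have a: "a \<in> quad_residues p" "Suc a \<in> quad_residues p" "0 < a" "Suc a < p"
      using that by (auto simp: consecutive_residues_def quad_residues_def)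
    then have "p - a \<in> quad_residues p" "p - Suc a \<in> quad_residues p"
      using minus_mem_quad_residues_iff[OF assms(1) p4] by auto
    moreover have "p - a = Suc (2 * (2 * k) - a)" "p - Suc a = 2 * (2 * k) - a"
      using a assms(2) by auto
    ultimately show ?thesis
      by (simp add: consecutive_residues_def)
  qed
  have "bij_betw (\<lambda>a. 2 * (2 * k) - a) ?lo ?hi"
  proof (rule bij_betwI[where g = "\<lambda>a. 2 * (2 * k) - a"])
    show "(\<lambda>a. 2 * (2 * k) - a) \<in> ?lo \<rightarrow> ?hi" "(\<lambda>a. 2 * (2 * k) - a) \<in> ?hi \<rightarrow> ?lo"
      using reflect k by auto
    show "2 * (2 * k) - (2 * (2 * k) - a) = a" if "a \<in> ?lo" for a
      using that by simp
    show "2 * (2 * k) - (2 * (2 * k) - a) = a" if "a \<in> ?hi" for a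
      using that assms(2) by (auto simp: consecutive_residues_def quad_residues_def)
  qed
  then have "card ?lo = card ?hi"
    by (rule bij_betw_same_card)
  moreover have "?A = ?lo \<union> ?hi \<union> (?A \<inter> {2 * k})"
    by auto
  then have "card ?A = card (?lo \<union> ?hi \<union> (?A \<inter> {2 * k}))"
    by simp
  moreover have "\<dots> = card ?lo + card ?hi + card (?A \<inter> {2 * k})"
    by (subst card_Un_disjoint; (subst card_Un_disjoint)?) auto
  ultimately have "odd (card ?A) \<longleftrightarrow> 2 * k \<in> ?A"
    by (cases "2 * k \<in> ?A") auto
  also have "\<dots> \<longleftrightarrow> 2 * k \<in> quad_residues p"
  proof -
    have "p - 2 * k = Suc (2 * k)"
      using assms(2) by simp
    then have "Suc (2 * k) \<in> quad_residues p \<longleftrightarrow> 2 * k \<in> quad_residues p"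
      using minus_mem_quad_residues_iff[OF assms(1) p4, of "2 * k"] k assms(2) by simp
    then show ?thesis
      by (simp add: consecutive_residues_def)
  qed
  also have "\<dots> \<longleftrightarrow> Legendre 2 p = 1"
  proof -
    have p2: "p > 2"
      using k assms(2) by simp
    have "1 ^ 2 \<in> quad_residues p"
      using p2 by (intro power2_mem_quad_residues) auto
    then have "p - 1 \<in> quad_residues p"
      using minus_mem_quad_residues_iff[OF assms(1) p4, of 1] p2 by simp
    then have "Legendre (int (p - 1)) p = 1"
      using p2 by (simp add: quad_residues_iff_Legendre)
    also have "int (p - 1) = 2 * int (2 * k)"
      using assms(2) by simp
    finally have "Legendre 2 p * Legendre (int (2 * k)) p = 1"
      using Legendre_mult[OF assms(1) p2, of 2 "int (2 * k)"] by metis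
    then have "Legendre 2 p = 1 \<longleftrightarrow> Legendre (int (2 * k)) p = 1"
      by (metis mult_1 mult_1_right)
    then show ?thesis
      using k assms(2) by (simp add: quad_residues_iff_Legendre)
  qed
  also have "\<dots> \<longleftrightarrow> even k"
    using Legendre_two[OF assms] by (cases "even k") auto
  finally show ?thesis .
qed

text \<open>
  The squares \<open>1\<close>, \<open>4\<close> and \<open>9\<close> are residues below \<open>p\<close>, and of their successors \<open>2\<close>, \<open>5\<close> and \<open>10 = 2 * 5\<close>
  at least one is a residue since the product of two nonresidues is a residue.
\<close>

lemma consecutive_residues_nonempty:
  assumes "prime p" "p > 10"
  shows "consecutive_residues p \<noteq> {}"
proof -
  have sq: "x ^ 2 \<in> quad_residues p" if "x \<in> {1, 2, 3}" for x :: nat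
    using that assms(2) by (intro power2_mem_quad_residues) auto
  have Q: "1 \<in> quad_residues p" "4 \<in> quad_residues p" "9 \<in> quad_residues p"
    using sq[of 1] sq[of 2] sq[of 3] by simp_all
  have leg: "Legendre 10 p = Legendre 2 p * Legendre 5 p"
    using Legendre_mult[of p 2 5] assms by simp
  have mem: "2 \<in> quad_residues p \<longleftrightarrow> Legendre 2 p = 1" "5 \<in> quad_residues p \<longleftrightarrow> Legendre 5 p = 1"
    "10 \<in> quad_residues p \<longleftrightarrow> Legendre 10 p = 1"
    using assms(2) quad_residues_iff_Legendre[of _ p] by force+
  have "2 \<in> quad_residues p \<or> 5 \<in> quad_residues p \<or> 10 \<in> quad_residues p"
    unfolding mem leg using Legendre_cases_nat[of 2 p] Legendre_cases_nat[of 5 p] assms(2) by auto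
  then have "1 \<in> consecutive_residues p \<or> 4 \<in> consecutive_residues p \<or> 9 \<in> consecutive_residues p"
    using Q by (auto simp: consecutive_residues_def numeral_2_eq_2[symmetric])
  then show ?thesis
    by blast
qed

text \<open>
  There are \<open>(p - 3) / 2\<close> residues apart from the last one, \<open>p - 1\<close>. If each of them were followed by
  another residue, induction from \<open>1\<close> would make every number below \<open>p\<close> a residue.
\<close>

lemma card_consecutive_residues_less:
  assumes "prime p" "p mod 4 = 1"
  shows "card (consecutive_residues p) < (p - 3) div 2"
proof -
  let ?Q = "quad_residues p"
  have p2: "p > 4"
    using assms prime_ge_2_nat[of p] by (cases "p = 2"; cases "p = 3"; cases "p = 4") auto
  have one: "1 \<in> ?Q"
    using power2_mem_quad_residues[of 1 p] p2 by simp
  then have last: "p - 1 \<in> ?Q"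
    using minus_mem_quad_residues_iff[OF assms, of 1] p2 by simp
  have card_Q: "card ?Q = (p - 1) div 2"
    using assms p2 by (intro card_quad_residues) auto
  have sub: "consecutive_residues p \<subseteq> ?Q - {p - 1}"
    by (auto simp: consecutive_residues_def quad_residues_def)
  have "consecutive_residues p \<noteq> ?Q - {p - 1}"
  proof
    assume eq: "consecutive_residues p = ?Q - {p - 1}"
    have "Suc n < p \<Longrightarrow> Suc n \<in> ?Q" for n
    proof (induction n)
      case (Suc n)
      then have "Suc n \<in> consecutive_residues p"
        unfolding eq by auto
      then show ?case
        by (simp add: consecutive_residues_def)
    qed (use one in simp)
    then have "{1..<p} \<subseteq> ?Q"
      by (metis Suc_pred atLeastLessThan_iff less_eq_Suc_le One_nat_def subsetI)
    then have "card {1..<p} \<le> card ?Q"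
      by (intro card_mono) auto
    then show False
      using card_Q p2 by simp
  qed
  then have "card (consecutive_residues p) < card (?Q - {p - 1})"
    using sub by (intro psubset_card_mono) auto
  then show ?thesis
    using card_Q last by simp
qed

text \<open>
  Nothing lies between \<open>a\<close> and \<open>a + 1\<close>, so if both belong to \<open>A\<close> they are adjacent entries of its
  increasing enumeration.
\<close>

lemma bij_betw_consecutive_positions:
  fixes A :: "nat set"
  assumes "finite A"
  defines "xs \<equiv> sorted_list_of_set A"
  shows "bij_betw (\<lambda>n. xs ! n) {n. Suc n < card A \<and> xs ! Suc n = Suc (xs ! n)} {a \<in> A. Suc a \<in> A}"
  unfolding bij_betw_def
proof (intro conjI equalityI subsetI)
  have xs: "set xs = A" "length xs = card A" "distinct xs" and sorted: "sorted_wrt (<) xs"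
    using assms(1) by (simp_all add: xs_def)
  let ?I = "{n. Suc n < card A \<and> xs ! Suc n = Suc (xs ! n)}"
  show "inj_on (\<lambda>n. xs ! n) ?I"
    using xs by (auto simp: inj_on_def nth_eq_iff_index_eq)
  have nth_in: "xs ! n \<in> A" if "n < card A" for n
    using nth_mem[of n xs] that xs by simp
  have nth_ex: "\<exists>n < card A. xs ! n = a" if "a \<in> A" for a
    using that unfolding xs(1)[symmetric] in_set_conv_nth xs(2) .
  show "a \<in> {a \<in> A. Suc a \<in> A}" if "a \<in> (\<lambda>n. xs ! n) ` ?I" for a
  proof -
    obtain n where "n \<in> ?I" "a = xs ! n"
      using \<open>a \<in> (\<lambda>n. xs ! n) ` ?I\<close> by blast
    then show ?thesis
      using nth_in[of n] nth_in[of "Suc n"] by simp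
  qed
  fix a assume "a \<in> {a \<in> A. Suc a \<in> A}"
  then obtain i j where ij: "i < card A" "xs ! i = a" "j < card A" "xs ! j = Suc a"
    using nth_ex by blast
  have less: "xs ! m < xs ! n" if "m < n" "n < card A" for m n
    using sorted_wrt_nth_less[OF sorted] that xs by simp
  have "i < j"
    using less[of j i] ij by (cases i j rule: linorder_cases) auto
  moreover have "\<not> Suc i < j"
    using less[of i "Suc i"] less[of "Suc i" j] ij by auto
  ultimately have "j = Suc i"
    by simp
  then show "a \<in> (\<lambda>n. xs ! n) ` ?I"
    using ij by (intro image_eqI[of _ _ i]) auto
qed

section \<open>The linear complexity\<close>

lemma card_ones_t_seq:
  assumes "prime p" "p > 4"
  shows "card {n. n < (p - 3) div 2 \<and> t_seq p n = 1} = card (consecutive_residues p)"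
proof -
  let ?xs = "sorted_list_of_set (quad_residues p)"
  have "odd p"
    using assms prime_odd_nat[of p] by simp
  then have "card (quad_residues p) = Suc ((p - 3) div 2)"
    using card_quad_residues[of p] assms by (auto elim!: oddE)
  then have "{n. n < (p - 3) div 2 \<and> t_seq p n = 1} =
      {n. Suc n < card (quad_residues p) \<and> ?xs ! Suc n = Suc (?xs ! n)}"
    by (auto simp: t_seq_def quad_residue_def quad_residues_def Let_def split: if_splits)
  then show ?thesis
    unfolding consecutive_residues_def
    using bij_betw_same_card[OF bij_betw_consecutive_positions[OF finite_quad_residues]]
    by (simp only:)
qed

theorem theorem4:
  fixes p r :: nat
  assumes "prime p"
    and "[p = 9] (mod 16) \<or> [p = 13] (mod 16)"
    and "r = (p - 3) div 2"
    and "prime r" and "odd r"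
    and "residue_primroot r 2"
  shows "linear_complexity (t_seq p) =
    (if [p = 9] (mod 16) then (p - 3) div 2 else (p - 5) div 2)"
proof -
  define k where "k = (p - 1) div 4"
  have mod16: "p mod 16 = 9 \<or> p mod 16 = 13"
    using assms(2) by (simp add: cong_def)
  obtain q where q: "p = 16 * q + 9 \<or> p = 16 * q + 13"
    using mod16 mult_div_mod_eq[of 16 p] by metis
  have p4: "p = 4 * k + 1" "p mod 4 = 1"
    using mod16 unfolding k_def by presburger+
  have "p \<noteq> 9"
  proof
    assume "p = 9"
    then have "3 dvd p"
      by simp
    then have "3 = p"
      using assms(1) primes_dvd_imp_eq[of 3 p] by simp
    then show False
      using \<open>p = 9\<close> by simp
  qed
  then have p10: "p > 10"
    using q by (cases "q = 0") auto
  have even_k: "even k \<longleftrightarrow> [p = 9] (mod 16)"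
    using q
  proof
    assume p: "p = 16 * q + 9"
    then have "k = 2 * (2 * q + 1)"
      using p p4(1) by simp
    then show ?thesis
      using p by (simp add: cong_def)
  next
    assume p: "p = 16 * q + 13"
    then have "k = 2 * (2 * q + 1) + 1"
      using p p4(1) by simp
    then show ?thesis
      using p by (simp add: cong_def)
  qed
  let ?ones = "{n. n < r \<and> t_seq p n = 1}"
  have ones: "card ?ones = card (consecutive_residues p)"
    using card_ones_t_seq[OF assms(1)] p10 assms(3) by simp
  have per: "t_seq p (n + r) = t_seq p n" for n
    by (simp add: t_seq_def assms(3))
  have nonconst: "\<exists>n. t_seq p n \<noteq> b" for b
  proof (cases "b = 0")
    case True
    have "card ?ones > 0"
      unfolding ones using consecutive_residues_nonempty[OF assms(1) p10]
      by (simp add: card_gt_0_iff)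
    then have "?ones \<noteq> {}"
      by force
    then show ?thesis
      using True by auto
  next
    case False
    have "card ?ones < card {..<r}"
      unfolding ones using card_consecutive_residues_less[OF assms(1) p4(2)] assms(3) by simp
    then have "?ones \<noteq> {..<r}"
      by force
    then show ?thesis
      using False by auto
  qed
  have "(\<Sum>m<r. t_seq p m) = (\<Sum>m\<in>?ones. 1)"
    by (intro sum.mono_neutral_cong_right) auto
  then have "(\<Sum>m<r. t_seq p m) = of_nat (card (consecutive_residues p))"
    using ones by simp
  also have "\<dots> = 0 \<longleftrightarrow> \<not> [p = 9] (mod 16)"
    using odd_card_consecutive_residues_iff[OF assms(1) p4(1)] even_k
    unfolding of_nat_bit_eq_0_iff by blast
  finally have "linear_complexity (t_seq p) = (if [p = 9] (mod 16) then r else r - 1)"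
    using linear_complexity_prime_period[OF per assms(4-6) nonconst] by simp
  moreover have "r - 1 = (p - 5) div 2"
    using assms(3) by simp
  ultimately show ?thesis
    using assms(3) by simp
qed

end
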